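(* Let $n = k+m$ and let $b_1,\dots,b_n \in \mathbb{R}^k$ be the column vectors of a $k\times n$ real matrix of the form $B = D\,[U \mid V]$, where $D \in \mathbb{R}^{k\times k}$ is diagonal with positive diagonal entries $d_1,\dots,d_k$, $U \in \mathbb{R}^{k\times k}$ is upper-triangular with ones along the diagonal, and $V \in \mathbb{R}^{k\times m}$. Suppose that: (i) $\operatorname{span}_{\mathbb{Z}}\{b_1,\dots,b_n\}$ is discrete; (ii) the row vectors $r_1,\dots,r_k$ of $B$ satisfy $\langle r_i, r_j\rangle = d_i d_j q_{i,j}$ for some $q_{i,j}\in\mathbb{Q}$, for all $i \neq j$; that is, $[U\mid V][U\mid V]^\top$ has rational entries off the diagonal; (iii) $\langle r_i, r_i\rangle = q_{i,i} \in \mathbb{Q}$ for all $i=1,\dots,k$; that is, $BB^\top = D[U\mid V][U\mid V]^\top D$ has rational entries on the diagonal. Then the inner products $\langle b_i, b_j\rangle$ are all rational, i.e. $B^\top B \in \mathbb{Q}^{n\times n}$.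
   Context: $[U\mid V]$ denotes the $k\times(k+m)$ matrix whose first $k$ columns are those of $U$ and whose last $m$ columns are those of $V$. $\langle\,,\rangle$ is the usual Euclidean inner product. "Discrete" means discrete as a subgroup of $\mathbb{R}^k$. *)

theory Defs
  imports Complex_Main "Jordan_Normal_Form.VS_Connect"
begin

text \<open>The block matrix \<open>[U | V]\<close>, for \<open>U\<close> and \<open>V\<close> with the same number of rows.\<close>

definition append_cols :: "'a mat \<Rightarrow> 'a mat \<Rightarrow> 'a mat" where
  "append_cols U V =
     mat (dim_row U) (dim_col U + dim_col V)
       (\<lambda>(i, j). if j < dim_col U then U $$ (i, j) else V $$ (i, j - dim_col U))"

definition euclidean_norm_vec :: "real vec \<Rightarrow> real" where
  "euclidean_norm_vec v = sqrt (v \<bullet> v)"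

text \<open>
  The type \<open>real vec\<close> contains vectors of all dimensions and carries no topology. For
  \<open>S \<subseteq> carrier_vec k\<close>, the following says that the topology induced on \<open>S\<close> by the Euclidean
  metric of \<open>\<real>\<^sup>k\<close> is discrete, i.e. that every point of \<open>S\<close> is isolated in \<open>S\<close>.
\<close>

definition discrete_vec_set :: "real vec set \<Rightarrow> bool" where
  "discrete_vec_set S \<longleftrightarrow>
     (\<forall>x\<in>S. \<exists>e>0. \<forall>y\<in>S. euclidean_norm_vec (y - x) < e \<longrightarrow> y = x)"

text \<open>
  \<open>lattice_of\<close> is the set of all integer linear combinations of a list of vectors; linear
  independence is not required, so it is the \<open>\<int>\<close>-span.
\<close>

abbreviation int_span :: "nat \<Rightarrow> real vec list \<Rightarrow> real vec set" where
  "int_span k \<equiv> vec_module.lattice_of k"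

end

theory Submission
  imports "HOL-Analysis.Kronecker_Approximation_Theorem" Defs
begin

text \<open>
  The matrix \<open>D U\<close> is invertible, so every column of \<open>B\<close> has coordinates \<open>y\<close> with respect to the
  first \<open>k\<close> columns. By Dirichlet's theorem some \<open>q y\<close> with \<open>q > 0\<close> is within \<open>\<epsilon>\<close> of an integer
  vector \<open>p\<close>; then \<open>D U (q y - p)\<close> is a short vector of the discrete lattice, hence zero, and \<open>y\<close>
  is rational. Thus \<open>[U | V] = U R\<close> with \<open>R\<close> rational.

  Going up from the last row, the \<open>i\<close>-th row of \<open>[U | V]\<close> minus the \<open>i\<close>-th row of \<open>R\<close> is a real
  combination of the lower rows of \<open>R\<close>, and it has rational inner products with them; a vector in
  the real span of rational vectors with this property is rational. So \<open>[U | V]\<close> is rational, the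
  diagonal condition then makes each \<open>d\<^sub>i\<^sup>2\<close> rational, and \<open>B\<^sup>T B = [U | V]\<^sup>T D\<^sup>2 [U | V]\<close>.
\<close>

no_notation inner (infix "\<bullet>" 70)
  and Finite_Cartesian_Product.vec.vec_nth (infixl "$" 90)

section \<open>Discrete lattices and Dirichlet approximation\<close>

lemma euclidean_norm_vec_le_sum_abs:
  "euclidean_norm_vec v \<le> (\<Sum>i = 0..<dim_vec v. \<bar>v $ i\<bar>)"
proof -
  have "euclidean_norm_vec v = L2_set (\<lambda>i. v $ i) {0..<dim_vec v}"
    by (simp add: euclidean_norm_vec_def L2_set_def scalar_prod_def power2_eq_square)
  then show ?thesis by (simp add: L2_set_le_sum_abs)
qed

lemma mult_int_vec_in_int_span_cols:
  assumes B: "B \<in> carrier_mat k n"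
  shows "B *\<^sub>v vec n (\<lambda>j. real_of_int (c j)) \<in> int_span k (cols B)"
proof -
  interpret vec_module "TYPE(real)" k .
  have len: "length (cols B) = n" using B by simp
  have sub: "set (map (\<lambda>i. of_int (c i) \<cdot>\<^sub>v (cols B ! i)) [0..<n]) \<subseteq> carrier_vec k"
    using B by auto
  have "B *\<^sub>v vec n (\<lambda>j. real_of_int (c j)) =
     sumlist (map (\<lambda>i. of_int (c i) \<cdot>\<^sub>v (cols B ! i)) [0..<n])" (is "?l = ?r")
  proof (rule eq_vecI)
    have dr: "?r \<in> carrier_vec k" using sub by (intro sumlist_carrier) auto
    then show "dim_vec ?l = dim_vec ?r" using B by simp
    fix i assume "i < dim_vec ?r"
    then have i: "i < k" using dr by simp
    have "?r $ i = (\<Sum>j = 0..<n. (of_int (c j) \<cdot>\<^sub>v (cols B ! j)) $ i)"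
      using sub i B by (subst sumlist_nth) (auto intro!: sum.cong)
    also have "\<dots> = ?l $ i"
      using B i by (auto simp: scalar_prod_def intro!: sum.cong)
    finally show "?l $ i = ?r $ i" by simp
  qed
  then show ?thesis unfolding lattice_of_def len by blast
qed

text \<open>Isolation of the origin turns an approximate integer relation among the columns into an
  exact one, and an exact relation with \<open>q > 0\<close> makes \<open>y\<close>
  rational.\<close>

lemma discrete_int_span_rational_coords:
  fixes B A :: "real mat"
  assumes B: "B \<in> carrier_mat k n" and kn: "k \<le> n"
    and discrete: "discrete_vec_set (int_span k (cols B))"
    and A: "A \<in> carrier_mat k k" and AB: "\<And>j. j < k \<Longrightarrow> col A j = col B j"
    and det: "det A \<noteq> 0"
    and y: "y \<in> carrier_vec k" and s: "s < n" and ys: "A *\<^sub>v y = col B s"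
    and t: "t < k"
  shows "y $ t \<in> \<rat>"
proof -
  let ?L = "int_span k (cols B)"
  have zero: "0\<^sub>v k \<in> ?L"
  proof -
    have "B *\<^sub>v vec n (\<lambda>j. real_of_int 0) = 0\<^sub>v k"
      using B by (intro eq_vecI) (auto simp: scalar_prod_def)
    then show ?thesis using mult_int_vec_in_int_span_cols[OF B, of "\<lambda>_. 0"] by simp
  qed
  then obtain e where e: "e > 0"
    and iso: "\<And>x. x \<in> ?L \<Longrightarrow> euclidean_norm_vec (x - 0\<^sub>v k) < e \<Longrightarrow> x = 0\<^sub>v k"
    using discrete unfolding discrete_vec_set_def by metis
  \<comment> \<open>If all entries of \<open>z\<close> are at most \<open>1 / real N\<close> in
    absolute value, then \<open>C / real N\<close> bounds the norm of \<open>A *\<^sub>v z\<close>;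
    \<open>N\<close> is chosen to push this below the isolation radius \<open>e\<close>.\<close>
  define C where "C = (\<Sum>i = 0..<k. \<Sum>t = 0..<k. \<bar>A $$ (i, t)\<bar>)"
  have C0: "C \<ge> 0" unfolding C_def by (intro sum_nonneg) auto
  obtain N :: nat where N: "C / e < real N" using reals_Archimedean2 by blast
  have N0: "0 < N" using N C0 e by (metis divide_nonneg_pos not_gr0 not_le of_nat_0)
  obtain q p where q: "0 < q"
    and p: "\<And>i. i < k \<Longrightarrow> \<bar>of_int q * y $ i - of_int (p i)\<bar> < 1 / real N"
    using Dirichlet_approx_simult[OF N0, of k "\<lambda>i. y $ i"] by metis
  define z where "z = vec k (\<lambda>i. of_int q * y $ i - of_int (p i))"
  have z: "z \<in> carrier_vec k" by (simp add: z_def)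
  \<comment> \<open>Coefficients of \<open>q\<close> times column \<open>s\<close> minus the
    combination \<open>p\<close> of the first \<open>k\<close> columns. If \<open>s < k\<close>,
    both terms contribute at index \<open>s\<close>.\<close>
  define c where "c = (\<lambda>j. (if j = s then q else 0) - (if j < k then p j else 0))"
  have eq: "B *\<^sub>v vec n (\<lambda>j. real_of_int (c j)) = A *\<^sub>v z"
  proof (rule eq_vecI)
    show "dim_vec (B *\<^sub>v vec n (\<lambda>j. real_of_int (c j))) = dim_vec (A *\<^sub>v z)" using A B by simp
    fix i assume "i < dim_vec (A *\<^sub>v z)"
    then have i: "i < k" using A by simp
    have AB': "A $$ (i, j) = B $$ (i, j)" if "j < k" for j
      using AB[OF that] that i A B kn by (metis carrier_matD index_col less_le_trans)
    have ys': "(\<Sum>t = 0..<k. A $$ (i, t) * y $ t) = B $$ (i, s)"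
      using arg_cong[OF ys, of "\<lambda>v. v $ i"] i A B s y by (simp add: scalar_prod_def)
    have "(B *\<^sub>v vec n (\<lambda>j. real_of_int (c j))) $ i = (\<Sum>j = 0..<n. B $$ (i, j) * of_int (c j))"
      using i B by (simp add: scalar_prod_def)
    also have "\<dots> = (\<Sum>j = 0..<n. (if j = s then of_int q * B $$ (i, j) else 0)
        - (if j < k then B $$ (i, j) * of_int (p j) else 0))"
      by (intro sum.cong) (auto simp: c_def algebra_simps)
    also have "\<dots> = of_int q * B $$ (i, s) - (\<Sum>j = 0..<n. if j < k then B $$ (i, j) * of_int (p j) else 0)"
      using s by (simp add: sum_subtractf)
    also have "(\<Sum>j = 0..<n. if j < k then B $$ (i, j) * of_int (p j) else 0)
        = (\<Sum>j = 0..<k. A $$ (i, j) * of_int (p j))"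
      using kn by (intro sum.mono_neutral_cong_right) (auto simp: AB')
    also have "of_int q * B $$ (i, s) - (\<Sum>j = 0..<k. A $$ (i, j) * of_int (p j)) = (A *\<^sub>v z) $ i"
      unfolding ys'[symmetric] using i A
      by (simp add: scalar_prod_def z_def sum_distrib_left sum_subtractf[symmetric] algebra_simps)
    finally show "(B *\<^sub>v vec n (\<lambda>j. real_of_int (c j))) $ i = (A *\<^sub>v z) $ i" .
  qed
  have "euclidean_norm_vec (A *\<^sub>v z) \<le> (\<Sum>i = 0..<k. \<bar>(A *\<^sub>v z) $ i\<bar>)"
    using euclidean_norm_vec_le_sum_abs[of "A *\<^sub>v z"] A by simp
  also have "\<dots> \<le> (\<Sum>i = 0..<k. \<Sum>t = 0..<k. \<bar>A $$ (i, t)\<bar> * (1 / real N))"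
  proof (intro sum_mono)
    fix i assume "i \<in> {0..<k}"
    then have "(A *\<^sub>v z) $ i = (\<Sum>t = 0..<k. A $$ (i, t) * z $ t)"
      using A z by (simp add: scalar_prod_def)
    also have "\<bar>\<dots>\<bar> \<le> (\<Sum>t = 0..<k. \<bar>A $$ (i, t) * z $ t\<bar>)" by (rule sum_abs)
    also have "\<dots> \<le> (\<Sum>t = 0..<k. \<bar>A $$ (i, t)\<bar> * (1 / real N))"
      unfolding abs_mult using p by (intro sum_mono mult_left_mono) (auto simp: z_def intro: less_imp_le)
    finally show "\<bar>(A *\<^sub>v z) $ i\<bar> \<le> (\<Sum>t = 0..<k. \<bar>A $$ (i, t)\<bar> * (1 / real N))" .
  qed
  also have "\<dots> = C / real N" by (simp add: C_def sum_divide_distrib)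
  also have "\<dots> < e" using N N0 e by (simp add: field_simps)
  finally have "euclidean_norm_vec (A *\<^sub>v z) < e" .
  moreover have "A *\<^sub>v z - 0\<^sub>v k = A *\<^sub>v z" using A by (intro eq_vecI) auto
  ultimately have "euclidean_norm_vec (A *\<^sub>v z - 0\<^sub>v k) < e" by simp
  then have "A *\<^sub>v z = 0\<^sub>v k"
    using iso mult_int_vec_in_int_span_cols[OF B, of c] unfolding eq by blast
  then have "z = 0\<^sub>v k" using det det_0_iff_vec_prod_zero[OF A] z by blast
  then have "of_int q * y $ t - of_int (p t) = 0" using t by (simp add: z_def vec_eq_iff)
  then have "y $ t = of_int (p t) / of_int q" using q by (simp add: field_simps)
  then show ?thesis by simp
qed

section \<open>Rationality in real spans and in triangular factorizations\<close>

text \<open>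
  The induction splits off the projection onto the last vector \<open>v r\<close>. If \<open>v r = 0\<close>, then the
  coefficients below are \<open>x / 0 = 0\<close> and the step is still valid.
\<close>

lemma real_combination_of_rational_vectors_rational:
  fixes v :: "nat \<Rightarrow> nat \<Rightarrow> real" and z p :: "nat \<Rightarrow> real"
  assumes "\<And>t j. t < r \<Longrightarrow> j < n \<Longrightarrow> v t j \<in> \<rat>"
    and "\<And>j. j < n \<Longrightarrow> p j = (\<Sum>t = 0..<r. z t * v t j)"
    and "\<And>t. t < r \<Longrightarrow> (\<Sum>j = 0..<n. p j * v t j) \<in> \<rat>"
    and "j < n"
  shows "p j \<in> \<rat>"
  using assms
proof (induction r arbitrary: v p j)
  case 0
  then show ?case by simp
next
  case (Suc r)
  note rat = Suc.prems(1) and p = Suc.prems(2) and inner = Suc.prems(3)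
  define a where "a = v r"
  define ip where "ip = (\<lambda>x y :: nat \<Rightarrow> real. \<Sum>j = 0..<n. x j * y j)"
  \<comment> \<open>\<open>P\<close> projects orthogonally to \<open>a\<close>; it keeps rational
    vectors rational because \<open>a\<close> is rational.\<close>
  define P where "P = (\<lambda>x j. x j - ip x a / ip a a * a j)"
  have ip_rat: "ip x y \<in> \<rat>" if "\<And>j. j < n \<Longrightarrow> x j \<in> \<rat>" "\<And>j. j < n \<Longrightarrow> y j \<in> \<rat>" for x y
    unfolding ip_def using that by (intro Rats_sum Rats_mult) auto
  have a_rat: "a j \<in> \<rat>" if "j < n" for j unfolding a_def using rat that by simp
  have P_rat: "P (v t) j \<in> \<rat>" if "t < Suc r" "j < n" for t j
    unfolding P_def using that rat a_rat ip_rat by (intro Rats_diff Rats_mult Rats_divide) auto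
  have ipaa: "ip a a = 0 \<Longrightarrow> j < n \<Longrightarrow> a j = 0" for j
    unfolding ip_def by (subst (asm) sum_nonneg_eq_0_iff) auto
  have Pa: "P a j = 0" if "j < n" for j
    unfolding P_def using ipaa that by (cases "ip a a = 0") auto
  have ip_p: "ip p a = (\<Sum>t = 0..<Suc r. z t * ip (v t) a)"
  proof -
    have "ip p a = (\<Sum>j = 0..<n. \<Sum>t = 0..<Suc r. z t * (v t j * a j))"
      unfolding ip_def using p
      by (intro sum.cong) (simp_all add: sum_distrib_right mult.assoc del: sum.op_ivl_Suc)
    also have "\<dots> = (\<Sum>t = 0..<Suc r. z t * ip (v t) a)"
      by (subst sum.swap) (simp only: ip_def sum_distrib_left)
    finally show ?thesis .
  qed
  \<comment> \<open>Linearity of \<open>P\<close> together with \<open>P a = 0\<close> removes the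
    last summand, whatever the real coefficient \<open>z r\<close> is.\<close>
  have Pp: "P p j = (\<Sum>t = 0..<r. z t * P (v t) j)" if j: "j < n" for j
  proof -
    have "P p j = (\<Sum>t = 0..<Suc r. z t * v t j) - (\<Sum>t = 0..<Suc r. z t * ip (v t) a) / ip a a * a j"
      unfolding P_def ip_p using p[OF j] by simp
    also have "\<dots> = (\<Sum>t = 0..<Suc r. z t * P (v t) j)"
      unfolding P_def
      by (simp only: right_diff_distrib sum_subtractf sum_divide_distrib sum_distrib_right
          times_divide_eq_right times_divide_eq_left mult.assoc)
    also have "\<dots> = (\<Sum>t = 0..<r. z t * P (v t) j)"
      using Pa[OF j] by (simp add: a_def)
    finally show ?thesis .
  qed
  have ip_commute: "ip x y = ip y x" for x y by (simp add: ip_def mult.commute)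
  have ip_P: "ip (P x) y = ip x y - ip x a / ip a a * ip a y" for x y
  proof -
    have "ip (\<lambda>j. x j - c * a j) y = ip x y - c * ip a y" for c
      by (simp add: ip_def left_diff_distrib sum_subtractf sum_distrib_left mult.assoc)
    then show ?thesis unfolding P_def .
  qed
  have ip_p_rat: "ip p (v t) \<in> \<rat>" if "t < Suc r" for t
    using inner[OF that] by (simp add: ip_def)
  \<comment> \<open>Rationality of \<open>p\<close> is still open, so \<open>ip_rat\<close> cannot
    be applied to it. Expanding both projections leaves only the products of \<open>p\<close> with
    the \<open>v t\<close>, rational by hypothesis, and products of rational vectors.\<close>
  have inner_P: "(\<Sum>j = 0..<n. P p j * P (v t) j) \<in> \<rat>" if t: "t < r" for t
  proof -
    have "ip p (v t) \<in> \<rat>" "ip p a \<in> \<rat>"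
      using ip_p_rat[of t] ip_p_rat[of r] t by (simp_all add: a_def)
    moreover have "ip (v t) a \<in> \<rat>" "ip a a \<in> \<rat>" "ip a (P (v t)) \<in> \<rat>"
      using ip_rat a_rat P_rat rat t by simp_all
    ultimately have "ip p (v t) - ip (v t) a / ip a a * ip p a - ip p a / ip a a * ip a (P (v t)) \<in> \<rat>"
      by (intro Rats_diff Rats_mult[of "_ / _"] Rats_divide)
    moreover have "ip (P p) (P (v t)) = ip p (P (v t)) - ip p a / ip a a * ip a (P (v t))"
      by (rule ip_P)
    moreover have "ip p (P (v t)) = ip p (v t) - ip (v t) a / ip a a * ip p a"
      unfolding ip_commute[of p] by (rule ip_P)
    ultimately have "ip (P p) (P (v t)) \<in> \<rat>" by simp
    then show ?thesis by (simp add: ip_def)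
  qed
  have "P p j \<in> \<rat>"
    using Suc.IH[of "\<lambda>t. P (v t)" "P p" j] P_rat Pp inner_P Suc.prems(4) by simp
  moreover have "ip p a / ip a a * a j \<in> \<rat>"
    using ip_p_rat[of r] a_rat ip_rat Suc.prems(4)
    by (auto simp: a_def[symmetric] intro!: Rats_mult Rats_divide)
  moreover have "p j = P p j + ip p a / ip a a * a j" by (simp add: P_def)
  ultimately show ?case by (metis Rats_add)
qed

text \<open>Here \<open>w\<close>, \<open>\<rho>\<close> and \<open>u\<close> stand for
  \<open>[U | V]\<close>, \<open>R\<close> and the strict upper part of \<open>U\<close> in
  \<open>[U | V] = U R\<close>. Since \<open>U\<close> is the left block of \<open>[U | V]\<close>,
  each row of \<open>w\<close> shown to be rational supplies rational coefficients
  \<open>u\<close>.\<close>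

lemma unitriangular_factor_rational:
  fixes w \<rho> u :: "nat \<Rightarrow> nat \<Rightarrow> real"
  assumes w: "\<And>i j. i < k \<Longrightarrow> j < n \<Longrightarrow> w i j = \<rho> i j + (\<Sum>t = Suc i..<k. u i t * \<rho> t j)"
    and \<rho>: "\<And>i j. i < k \<Longrightarrow> j < n \<Longrightarrow> \<rho> i j \<in> \<rat>"
    and gram: "\<And>i j. i < j \<Longrightarrow> j < k \<Longrightarrow> (\<Sum>l = 0..<n. w i l * w j l) \<in> \<rat>"
    and u: "\<And>i j. i < j \<Longrightarrow> j < k \<Longrightarrow> u i j = w i j" and kn: "k \<le> n"
    and i: "i < k" and j: "j < n"
  shows "w i j \<in> \<rat>"
proof -
  \<comment> \<open>The second conjunct strengthens the induction: row \<open>i\<close> needs its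
    inner products with the lower rows of \<open>\<rho>\<close>, while \<open>gram\<close> only
    speaks of rows of \<open>w\<close>.\<close>
  have "(\<forall>j<n. w i j \<in> \<rat>) \<and> (\<forall>s<i. (\<Sum>l = 0..<n. w s l * \<rho> i l) \<in> \<rat>)"
    using i
  proof (induction "k - i" arbitrary: i rule: less_induct)
    case less
    note i = less.prems
    have IH: "(\<Sum>l = 0..<n. w s l * \<rho> t l) \<in> \<rat>" if "i < t" "t < k" "s < t" for s t
      using less.hyps[of t] that by simp
    define p where "p = (\<lambda>j. w i j - \<rho> i j)"
    have p_rat: "p j \<in> \<rat>" if "j < n" for j
    \<comment> \<open>The rows \<open>Suc i\<close>, ..., \<open>k - 1\<close> are renumbered from
      0.\<close>
    proof (rule real_combination_of_rational_vectors_rational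
        [where v = "\<lambda>t. \<rho> (t + Suc i)" and z = "\<lambda>t. u i (t + Suc i)" and r = "k - Suc i" and n = n])
      show "p j = (\<Sum>t = 0..<k - Suc i. u i (t + Suc i) * \<rho> (t + Suc i) j)" if "j < n" for j
        using w[OF i that] i sum.shift_bounds_nat_ivl[of "\<lambda>t. u i t * \<rho> t j" 0 "Suc i" "k - Suc i"]
        by (simp add: p_def)
      show "(\<Sum>j = 0..<n. p j * \<rho> (t + Suc i) j) \<in> \<rat>" if "t < k - Suc i" for t
      proof -
        have "(\<Sum>j = 0..<n. p j * \<rho> (t + Suc i) j)
            = (\<Sum>j = 0..<n. w i j * \<rho> (t + Suc i) j) - (\<Sum>j = 0..<n. \<rho> i j * \<rho> (t + Suc i) j)"
          by (simp add: p_def left_diff_distrib sum_subtractf)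
        moreover have "(\<Sum>j = 0..<n. \<rho> i j * \<rho> (t + Suc i) j) \<in> \<rat>"
          using that i \<rho> by (intro Rats_sum Rats_mult) auto
        ultimately show ?thesis using IH[of "t + Suc i" i] that by simp
      qed
    qed (use \<rho> that in auto)
    have w_rat: "w i j \<in> \<rat>" if "j < n" for j
      using Rats_add[OF p_rat[OF that] \<rho>[OF i that]] by (simp add: p_def)
    \<comment> \<open>Solving the factorization for \<open>\<rho> i\<close> reduces this to
      \<open>gram\<close> and to lower rows; the coefficients \<open>u i t\<close> are rational
      because row \<open>i\<close> of \<open>w\<close> now is.\<close>
    have "(\<Sum>l = 0..<n. w s l * \<rho> i l) \<in> \<rat>" if s: "s < i" for s
    proof -
      have "(\<Sum>l = 0..<n. w s l * \<rho> i l)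
          = (\<Sum>l = 0..<n. w s l * w i l - (\<Sum>t = Suc i..<k. u i t * (w s l * \<rho> t l)))"
        using w[OF i] by (intro sum.cong) (simp_all add: sum_distrib_left algebra_simps)
      also have "\<dots> = (\<Sum>l = 0..<n. w s l * w i l)
          - (\<Sum>t = Suc i..<k. u i t * (\<Sum>l = 0..<n. w s l * \<rho> t l))"
        unfolding sum_subtractf sum_distrib_left by (subst (2) sum.swap) simp
      also have "\<dots> \<in> \<rat>"
      proof (intro Rats_diff[OF gram[OF s i]] Rats_sum)
        show "u i t * (\<Sum>l = 0..<n. w s l * \<rho> t l) \<in> \<rat>" if "t \<in> {Suc i..<k}" for t
          using that IH[of t s] w_rat[of t] u[of i t] s kn by simp
      qed
      finally show ?thesis .
    qed
    then show ?case using w_rat by blast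
  qed
  then show ?thesis using j by blast
qed

section \<open>Rationality of the Gram matrix\<close>

theorem theorem2p2:
  fixes k m n :: nat
    and B D U V :: "real mat"
    and d :: "nat \<Rightarrow> real"
    and q :: "nat \<Rightarrow> nat \<Rightarrow> rat"
  assumes n: "n = k + m"
    and D: "D = mat_diag k d" and d_pos: "\<And>i. i < k \<Longrightarrow> d i > 0"
    and U: "U \<in> carrier_mat k k" "upper_triangular U" "\<And>i. i < k \<Longrightarrow> U $$ (i, i) = 1"
    and V: "V \<in> carrier_mat k m"
    and B: "B = D * append_cols U V"
    and discrete: "discrete_vec_set (int_span k (cols B))"
    and off_diag: "\<And>i j. i < k \<Longrightarrow> j < k \<Longrightarrow> i \<noteq> j \<Longrightarrow>
          row B i \<bullet> row B j = d i * d j * of_rat (q i j)"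
    and diag: "\<And>i. i < k \<Longrightarrow> row B i \<bullet> row B i = of_rat (q i i)"
  shows "\<forall>i<n. \<forall>j<n. col B i \<bullet> col B j \<in> \<rat>"
proof -
  define W where "W = append_cols U V"
  have W: "W \<in> carrier_mat k n" using U(1) V n by (simp add: W_def append_cols_def)
  have kn: "k \<le> n" using n by simp
  have WU: "W $$ (i, j) = U $$ (i, j)" if "i < k" "j < k" for i j
    using that U(1) V by (simp add: W_def append_cols_def)
  have Dc: "D \<in> carrier_mat k k" by (simp add: D)
  have Bc: "B \<in> carrier_mat k n" using B W Dc by (simp add: W_def)
  have DX: "(D * X) $$ (i, j) = d i * X $$ (i, j)" if "X \<in> carrier_mat k r" "i < k" "j < r" for X i j r
    unfolding D using that by (subst mat_diag_mult_left) auto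
  have B_eq: "B $$ (i, j) = d i * W $$ (i, j)" if "i < k" "j < n" for i j
    using DX[OF W that] by (simp add: B W_def)
  define A where "A = D * U"
  have A: "A \<in> carrier_mat k k" using Dc U(1) by (simp add: A_def)
  have A_eq: "A $$ (i, j) = d i * U $$ (i, j)" if "i < k" "j < k" for i j
    using DX[OF U(1) that] by (simp add: A_def)
  have colA: "col A j = col B j" if "j < k" for j
    using that A Bc kn by (intro eq_vecI) (auto simp: A_eq B_eq WU)
  have detA: "det A \<noteq> 0"
  proof -
    have "upper_triangular A"
      using A U by (auto simp: A_eq upper_triangular_def)
    then have "det A = prod_list (diag_mat A)" using A by (rule det_upper_triangular)
    moreover have "0 \<notin> set (diag_mat A)"
      using A U(3) d_pos by (fastforce simp: diag_mat_def A_eq)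
    ultimately show ?thesis by (simp add: prod_list_zero_iff)
  qed
  obtain A' where A': "A' \<in> carrier_mat k k" "A * A' = 1\<^sub>m k"
    using det_non_zero_imp_unit[OF A detA, of undefined] A
    unfolding Units_def ring_mat_def by auto
  define y where "y = (\<lambda>j. A' *\<^sub>v col B j)"
  have y: "y j \<in> carrier_vec k" for j using A' by (intro carrier_vecI) (simp add: y_def)
  have Ay: "A *\<^sub>v y j = col B j" if "j < n" for j
    using A A' Bc that unfolding y_def by (subst assoc_mult_mat_vec[symmetric]) auto
  have y_rat: "y j $ t \<in> \<rat>" if "j < n" "t < k" for j t
    using discrete_int_span_rational_coords
      [OF Bc kn discrete A colA detA y that(1) Ay[OF that(1)] that(2)] .
  \<comment> \<open>Row \<open>i\<close> of \<open>A *\<^sub>v y j = col B j\<close> carries the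
    factor \<open>d i\<close> on both sides; cancelling it gives \<open>W = U R\<close>, where
    \<open>R\<close> has columns \<open>y j\<close>.\<close>
  have W_eq: "W $$ (i, j) = y j $ i + (\<Sum>t = Suc i..<k. W $$ (i, t) * y j $ t)"
    if ij: "i < k" "j < n" for i j
  proof -
    have "d i * W $$ (i, j) = (A *\<^sub>v y j) $ i"
      using Ay[OF ij(2)] B_eq[OF ij] Bc ij by simp
    also have "\<dots> = (\<Sum>t = 0..<k. d i * (U $$ (i, t) * y j $ t))"
      using ij A y[of j] by (simp add: scalar_prod_def A_eq mult.assoc)
    finally have "W $$ (i, j) = (\<Sum>t = 0..<k. U $$ (i, t) * y j $ t)"
      using d_pos[OF ij(1)] by (simp add: sum_distrib_left[symmetric])
    also have "\<dots> = (\<Sum>t = i..<k. U $$ (i, t) * y j $ t)"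
      using U(1,2) ij by (intro sum.mono_neutral_right) (auto simp: upper_triangular_def)
    also have "\<dots> = y j $ i + (\<Sum>t = Suc i..<k. U $$ (i, t) * y j $ t)"
      using ij U(3) by (simp add: sum.atLeast_Suc_lessThan)
    finally show ?thesis using ij by (simp add: WU)
  qed
  have row_prod: "row B i \<bullet> row B j = d i * d j * (\<Sum>l = 0..<n. W $$ (i, l) * W $$ (j, l))"
    if "i < k" "j < k" for i j
    using that Bc by (simp add: scalar_prod_def B_eq sum_distrib_left algebra_simps)
  have gram: "(\<Sum>l = 0..<n. W $$ (i, l) * W $$ (j, l)) \<in> \<rat>" if "i < j" "j < k" for i j
  proof -
    have "(\<Sum>l = 0..<n. W $$ (i, l) * W $$ (j, l)) = of_rat (q i j)"
      using off_diag[of i j] row_prod[of i j] that d_pos[of i] d_pos[of j] by simp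
    then show ?thesis by simp
  qed
  have W_rat: "W $$ (i, j) \<in> \<rat>" if "i < k" "j < n" for i j
    using unitriangular_factor_rational
      [where w = "\<lambda>i j. W $$ (i, j)" and \<rho> = "\<lambda>i j. y j $ i" and u = "\<lambda>i j. W $$ (i, j)",
        OF W_eq y_rat gram refl kn that] .
  have d_rat: "d i * d i \<in> \<rat>" if i: "i < k" for i
  proof -
    let ?s = "\<Sum>l = 0..<n. W $$ (i, l) * W $$ (i, l)"
    \<comment> \<open>The unit diagonal of \<open>U\<close> keeps row \<open>i\<close> of
      \<open>W\<close> from vanishing, so \<open>diag\<close> can be solved for
      \<open>d i * d i\<close>.\<close>
    have "W $$ (i, i) * W $$ (i, i) \<le> ?s"
      using i kn by (intro member_le_sum) auto
    then have "?s > 0" using WU[OF i i] U(3)[OF i] by simp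
    then have "d i * d i = of_rat (q i i) / ?s"
      using diag[OF i] row_prod[OF i i] by (simp add: field_simps)
    then show ?thesis using W_rat i by (auto intro!: Rats_divide Rats_sum Rats_mult)
  qed
  show ?thesis
  proof (intro allI impI)
    fix i j assume ij: "i < n" "j < n"
    \<comment> \<open>Only squares of the \<open>d s\<close> occur; \<open>d s\<close> itself may be
      irrational.\<close>
    have "col B i \<bullet> col B j = (\<Sum>s = 0..<k. d s * d s * (W $$ (s, i) * W $$ (s, j)))"
      using ij Bc by (simp add: scalar_prod_def B_eq algebra_simps)
    also have "\<dots> \<in> \<rat>" using ij W_rat d_rat by (intro Rats_sum Rats_mult[of "d _ * d _"]) auto
    finally show "col B i \<bullet> col B j \<in> \<rat>" .
  qed
qed

end
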